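(* Let $(G,\mathfrak S)$ be a hierarchically hyperbolic group, and let $\overline{\mathfrak S}\subseteq\mathfrak S$ be the set of unbounded domains, i.e. those $U\in\mathfrak S$ for which $\mathcal C U$ is unbounded. Then there is a finite, $G$-invariant set $\mathcal E(G)\subseteq\overline{\mathfrak S}$ of pairwise orthogonal domains such that every $U\in\overline{\mathfrak S}$ is nested in some element of $\mathcal E(G)$.
   Context: **Hierarchically hyperbolic spaces (HHSs).** Let $X$ be a quasigeodesic metric space. An HHS structure $(X,\mathfrak S)$ consists of a set $\mathfrak S$ of *domains*, a constant $E\ge 1$, and for each $U\in\mathfrak S$ a geodesic $E$-hyperbolic space $\mathcal C U$, with the following data and axioms. (Distance between sets means infimal distance. One writes $d_U$ for distance in $\mathcal C U$ and suppresses $\pi_U$: $d_U(x,y)=d_{\mathcal C U}(\pi_U(x),\pi_U(y))$ for $x,y\in X$, $d_U(x,A)=d_{\mathcal C U}(\pi_U(x),A)$ for $A\subseteq\mathcal C U$.) 1. *Projections.* Maps $\pi_U:X\to\mathcal C U$ with $d_U(x,y)\le E\,d_X(x,y)+E$, and every point of $\mathcal C U$ is within $E$ of $\pi_U(X)$. 2. *Nesting.* A partial order $\sqsubseteq$ on $\mathfrak S$ with a unique maximal element (if $\mathfrak S\neq\varnothing$). $V\sqsubset W$ means $V\sqsubseteq W$, $V\ne W$ ("properly nested"). $\mathfrak S_W=\{V:V\sqsubseteq W\}$. If $V\sqsubset W$ there are a specified nonempty $\rho^V_W\subseteq\mathcal C W$ of diameter $\le E$ and a map $\rho^W_V:\mathcal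 C W\to 2^{\mathcal C V}$. 3. *Orthogonality.* A symmetric antireflexive relation $\bot$. If $V\sqsubseteq W$ and $W\bot U$ then $V\bot U$. If $V\bot W$ then $V,W$ are not $\sqsubseteq$-comparable. For each $T\in\mathfrak S$ and $U\in\mathfrak S_T$ with $\{V\in\mathfrak S_T:V\bot U\}\ne\varnothing$ there is $W\in\mathfrak S_T\smallsetminus\{T\}$ such that $V\sqsubseteq W$ whenever $V\in\mathfrak S_T$, $V\bot U$. 4. *Transversality and consistency.* If $V,W$ are distinct, not orthogonal and not $\sqsubseteq$-comparable they are *transverse*, $V\pitchfork W$; then there are nonempty sets $\rho^V_W\subseteq\mathcal C W$, $\rho^W_V\subseteq\mathcal C V$ of diameter $\le E$ with $\min\{d_W(x,\rho^V_W),d_V(x,\rho^W_V)\}\le E$ for all $x\in X$. If $V\sqsubset W$ then $\min\{d_W(x,\rho^V_W),\operatorname{diam}(\{\pi_V(x)\}\cup\rho^W_V(\pi_W(x)))\}\le E$ for all $x\in X$. If $U\sqsubseteq V$ then $d_W(\rho^U_W,\rho^V_W)\le E$ whenever $V\sqsubset W$, or $V\pitchfork W$ and $W\not\perp U$. 5. *Finite complexity.* The cardinality of $\sqsubseteq$-chains is bounded; the maximum is the *complexity*. 6. *Large links.* For $W\in\mathfrak S$, $x,x'\in X$ let $N=E\,d_W(x,x')+E$. There are $T_1,\dots,T_{\lfloor N\rfloor}\in\mathfrak S_W\smallsetminus\{W\}$ such that each $T\in\mathfrak S_W\smallsetminus\{W\}$ is nested in some $T_i$ or has $d_T(x,x')<E$;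 and $d_W(x,\rho^{T_i}_W)\le N$ for all $i$. 7. *Bounded geodesic image.* If $V\sqsubset W$ and $\gamma$ is a geodesic of $\mathcal C W$, then $\operatorname{diam}\rho^W_V(\gamma)\le E$ or $\gamma$ meets the $E$-neighbourhood of $\rho^V_W$. Moreover if $y,z\in X$ have $d_V(y,z)>E$ then $\rho^V_W$ is $E$-close to every geodesic $[\pi_W(y),\pi_W(z)]$. 8. *Partial realisation.* If $\{W_i\}$ are pairwise orthogonal and $p_i\in\mathcal C W_i$, there is $x\in X$ with $d_{W_i}(x,p_i)\le E$ for all $i$ and $d_V(x,\rho^{W_i}_V)\le E$ whenever $W_i\sqsubset V$ or $W_i\pitchfork V$. 9. *Uniqueness.* For each $\kappa$ there is $\theta_u(\kappa)$ such that if $d_X(x,y)>\theta_u(\kappa)$ then $d_U(x,y)>\kappa$ for some $U\in\mathfrak S$. **Hierarchically hyperbolic groups (HHGs).** A finitely generated group $G$ with an HHS structure $(G,\mathfrak S)$ on $G$ (with a word metric) is an HHG if: $G$ acts on $\mathfrak S$ with finitely many orbits, preserving $\sqsubseteq,\bot,\pitchfork$; for $g\in G$, $U\in\mathfrak S$ there is an isometry $g:\mathcal C U\to\mathcal C gU$, with the isometry of a product $gh$ equal to the composition; and $g\pi_U(x)=\pi_{gU}(gx)$, $g\rho^V_U=\rho^{gV}_{gU}$ for all $g,x\in G$ and $U,V$ with $U\pitchfork V$ or $V\sqsubset U$. By cofiniteness, $E$ is also chosen so that $\operatorname{diam}\mathcal C U>E$ implies $\operatorname{diam}\mathcal C U=\infty$.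 *)

theory Defs
  imports "HOL-Analysis.Analysis" "HOL-Algebra.Generated_Groups" "HOL-Algebra.Group_Action"
begin

section \<open>Coarse metric notions\<close>

text \<open>
  Diameters and distances between sets take values in \<^typ>\<open>ennreal\<close>, so that unbounded sets have
  diameter \<^term>\<open>\<infinity>\<close>, the empty set has diameter 0, and the distance to the empty set
  is \<^term>\<open>\<infinity>\<close>.
\<close>

definition mdiam :: "'a metric \<Rightarrow> 'a set \<Rightarrow> ennreal" where
  "mdiam m A = (SUP x\<in>A. SUP y\<in>A. ennreal (mdist m x y))"

definition msetdist :: "'a metric \<Rightarrow> 'a set \<Rightarrow> 'a set \<Rightarrow> ennreal" where
  "msetdist m A B = (INF x\<in>A. INF y\<in>B. ennreal (mdist m x y))"

definition geodesic_segment :: "'a metric \<Rightarrow> 'a \<Rightarrow> 'a \<Rightarrow> 'a set \<Rightarrow> bool" where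
  "geodesic_segment m x y P \<longleftrightarrow>
     (\<exists>\<gamma> \<in> {0..mdist m x y} \<rightarrow> mspace m.
        \<gamma> 0 = x \<and> \<gamma> (mdist m x y) = y \<and>
        (\<forall>s\<in>{0..mdist m x y}. \<forall>t\<in>{0..mdist m x y}. mdist m (\<gamma> s) (\<gamma> t) = \<bar>s - t\<bar>) \<and>
        P = \<gamma> ` {0..mdist m x y})"

definition geodesic_space :: "'a metric \<Rightarrow> bool" where
  "geodesic_space m \<longleftrightarrow> (\<forall>x\<in>mspace m. \<forall>y\<in>mspace m. \<exists>P. geodesic_segment m x y P)"

definition quasigeodesic_space :: "'a metric \<Rightarrow> bool" where
  "quasigeodesic_space m \<longleftrightarrow>
     (\<exists>K\<ge>1. \<exists>c\<ge>0. \<forall>x\<in>mspace m. \<forall>y\<in>mspace m. \<exists>L\<ge>0. \<exists>\<gamma> \<in> {0..L} \<rightarrow> mspace m.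
        \<gamma> 0 = x \<and> \<gamma> L = y \<and>
        (\<forall>s\<in>{0..L}. \<forall>t\<in>{0..L}.
           \<bar>s - t\<bar> / K - c \<le> mdist m (\<gamma> s) (\<gamma> t) \<and>
           mdist m (\<gamma> s) (\<gamma> t) \<le> K * \<bar>s - t\<bar> + c))"

text \<open>Hyperbolicity in the sense of slim triangles.\<close>

definition hyperbolic_space :: "real \<Rightarrow> 'a metric \<Rightarrow> bool" where
  "hyperbolic_space \<delta> m \<longleftrightarrow>
     (\<forall>x y z P Q R. geodesic_segment m x y P \<and> geodesic_segment m y z Q \<and> geodesic_segment m x z R \<longrightarrow>
        (\<forall>p\<in>P. \<exists>q\<in>Q \<union> R. mdist m p q \<le> \<delta>))"


section \<open>Word metrics\<close>

definition word_length :: "('g, 'b) monoid_scheme \<Rightarrow> 'g set \<Rightarrow> 'g \<Rightarrow> nat" where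
  "word_length G A g =
     (LEAST n. \<exists>ws. length ws = n \<and> set ws \<subseteq> A \<union> m_inv G ` A \<and> foldr (mult G) ws \<one>\<^bsub>G\<^esub> = g)"

text \<open>
  The locale \<^locale>\<open>Metric_space\<close> asks for symmetry on the whole type, hence the dummy value 0
  outside the carrier.
\<close>

definition word_dist :: "('g, 'b) monoid_scheme \<Rightarrow> 'g set \<Rightarrow> 'g \<Rightarrow> 'g \<Rightarrow> real" where
  "word_dist G A x y =
     (if x \<in> carrier G \<and> y \<in> carrier G then real (word_length G A (inv\<^bsub>G\<^esub> x \<otimes>\<^bsub>G\<^esub> y)) else 0)"

definition word_metric :: "('g, 'b) monoid_scheme \<Rightarrow> 'g set \<Rightarrow> 'g metric" where
  "word_metric G A = metric (carrier G, word_dist G A)"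

lemma (in group) Metric_space_word_dist:
  assumes A: "A \<subseteq> carrier G" and gen: "generate G A = carrier G"
  shows "Metric_space (carrier G) (word_dist G A)"
proof -
  let ?S = "A \<union> m_inv G ` A"
  let ?ev = "\<lambda>ws. foldr (mult G) ws \<one>"
  have S: "?S \<subseteq> carrier G" using A by auto
  have ev_closed: "?ev ws \<in> carrier G" if "set ws \<subseteq> ?S" for ws
    using that S by (induction ws) auto
  have ev_append: "?ev (us @ vs) = ?ev us \<otimes> ?ev vs" if "set us \<subseteq> ?S" "set vs \<subseteq> ?S" for us vs
    using that
  proof (induction us)
    case (Cons u us)
    have "u \<in> carrier G" using Cons.prems S by auto
    then show ?case using Cons ev_closed[of us] ev_closed[of vs] by (simp add: m_assoc)
  qed (simp add: ev_closed)
  have ev_inv: "\<exists>vs. length vs = length ws \<and> set vs \<subseteq> ?S \<and> ?ev vs = inv (?ev ws)"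
    if "set ws \<subseteq> ?S" for ws
    using that
  proof (induction ws)
    case (Cons w ws)
    then obtain vs where vs: "length vs = length ws" "set vs \<subseteq> ?S" "?ev vs = inv (?ev ws)"
      by auto
    have w: "w \<in> ?S" "w \<in> carrier G" using Cons.prems S by auto
    have iw: "inv w \<in> ?S"
    proof (cases "w \<in> A")
      case False
      then obtain a where "a \<in> A" "w = inv a" using w by auto
      then show ?thesis using A by auto
    qed simp
    have "?ev (vs @ [inv w]) = inv (?ev ws) \<otimes> inv w"
      using ev_append[of vs "[inv w]"] vs iw w by simp
    also have "\<dots> = inv (?ev (w # ws))"
      using Cons.prems ev_closed[of ws] w by (simp add: inv_mult_group)
    finally show ?case
      using vs iw by (intro exI[of _ "vs @ [inv w]"]) auto
  qed simp
  have ex: "\<exists>ws. set ws \<subseteq> ?S \<and> ?ev ws = g" if "g \<in> carrier G" for g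
  proof -
    have "g \<in> generate G A" using that gen by simp
    then show ?thesis
    proof induction
      case one
      then show ?case by (intro exI[of _ "[]"]) simp
    next
      case (incl h)
      then show ?case using A by (intro exI[of _ "[h]"]) auto
    next
      case (inv h)
      then show ?case using A by (intro exI[of _ "[m_inv G h]"]) auto
    next
      case (eng h1 h2)
      then obtain us vs where "set us \<subseteq> ?S" "?ev us = h1" "set vs \<subseteq> ?S" "?ev vs = h2"
        by auto
      then show ?case using ev_append[of us vs] by (intro exI[of _ "us @ vs"]) auto
    qed
  qed
  let ?l = "word_length G A"
  have le: "?l (?ev ws) \<le> length ws" if "set ws \<subseteq> ?S" for ws
    unfolding word_length_def using that by (intro Least_le) auto
  have att: "\<exists>ws. length ws = ?l g \<and> set ws \<subseteq> ?S \<and> ?ev ws = g" if "g \<in> carrier G" for g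
    unfolding word_length_def by (rule LeastI_ex) (use ex[OF that] in auto)
  have l_inv_le: "?l (inv g) \<le> ?l g" if g: "g \<in> carrier G" for g
    using att[OF g] ev_inv le by metis
  have l_inv: "?l (inv g) = ?l g" if g: "g \<in> carrier G" for g
    using l_inv_le[OF g] l_inv_le[of "inv g"] g by simp
  have l_mult: "?l (g \<otimes> h) \<le> ?l g + ?l h" if g: "g \<in> carrier G" and h: "h \<in> carrier G" for g h
  proof -
    obtain us vs where "length us = ?l g" "set us \<subseteq> ?S" "?ev us = g"
      and "length vs = ?l h" "set vs \<subseteq> ?S" "?ev vs = h"
      using att[OF g] att[OF h] by auto
    then show ?thesis using le[of "us @ vs"] ev_append[of us vs] by auto
  qed
  have l_one: "?l \<one> = 0" using le[of "[]"] by simp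
  have l_zero: "g = \<one>" if "g \<in> carrier G" "?l g = 0" for g
    using att[OF that(1)] that(2) by auto
  show ?thesis
  proof
    fix x y
    show "word_dist G A x y = word_dist G A y x"
      using l_inv[of "inv x \<otimes> y"] by (auto simp: word_dist_def inv_mult_group)
  next
    fix x y assume xy: "x \<in> carrier G" "y \<in> carrier G"
    show "word_dist G A x y = 0 \<longleftrightarrow> x = y"
    proof
      assume "word_dist G A x y = 0"
      then have "?l (inv x \<otimes> y) = 0" using xy by (simp add: word_dist_def)
      then have "inv x \<otimes> y = \<one>" using l_zero xy by simp
      then have "inv y = inv x" using inv_equality xy by simp
      then show "x = y" using inv_inv xy by metis
    qed (use xy l_one in \<open>simp add: word_dist_def\<close>)
  next
    fix x y z assume xyz: "x \<in> carrier G" "y \<in> carrier G" "z \<in> carrier G"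
    have "inv x \<otimes> z = (inv x \<otimes> y) \<otimes> (inv y \<otimes> z)"
    proof -
      have "y \<otimes> (inv y \<otimes> z) = z"
        using xyz m_assoc[of y "inv y" z] by simp
      then show ?thesis using xyz by (simp add: m_assoc)
    qed
    then show "word_dist G A x z \<le> word_dist G A x y + word_dist G A y z"
      using l_mult[of "inv x \<otimes> y" "inv y \<otimes> z"] xyz
      by (simp add: word_dist_def flip: of_nat_add)
  qed (simp add: word_dist_def)
qed

lemma (in group) word_metric_simps:
  assumes "A \<subseteq> carrier G" "generate G A = carrier G"
  shows "mspace (word_metric G A) = carrier G" "mdist (word_metric G A) = word_dist G A"
  using Metric_space_word_dist[OF assms]
  by (simp_all add: word_metric_def Metric_space.mspace_metric Metric_space.mdist_metric)



section \<open>Hierarchically hyperbolic spaces\<close>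

text \<open>
  The spaces \<open>C U\<close> all live in one type \<open>'c\<close>; this is no restriction, since any family of metric
  spaces can be realised inside its disjoint union.
  \<open>\<rho> V W\<close> is the set $\rho^V_W \subseteq \mathcal{C} W$ (for \<open>V\<close> properly nested in or transverse
  to \<open>W\<close>), and \<open>\<rho>map W V\<close> is the map $\rho^W_V : \mathcal{C} W \to 2^{\mathcal{C} V}$
  (for \<open>V\<close> properly nested in \<open>W\<close>).
\<close>

locale hhs_data =
  fixes X :: "'x metric"
    and \<SS> :: "'u set"
    and E :: real
    and C :: "'u \<Rightarrow> 'c metric"
    and \<pi> :: "'u \<Rightarrow> 'x \<Rightarrow> 'c"
    and nest :: "'u \<Rightarrow> 'u \<Rightarrow> bool"  (infix "\<sqsubseteq>" 50)
    and orth :: "'u \<Rightarrow> 'u \<Rightarrow> bool"  (infix "\<bottom>" 50)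
    and \<rho> :: "'u \<Rightarrow> 'u \<Rightarrow> 'c set"
    and \<rho>map :: "'u \<Rightarrow> 'u \<Rightarrow> 'c \<Rightarrow> 'c set"
begin

definition pnest :: "'u \<Rightarrow> 'u \<Rightarrow> bool"  (infix "\<sqsubset>" 50) where
  "V \<sqsubset> W \<longleftrightarrow> V \<sqsubseteq> W \<and> V \<noteq> W"

definition transverse :: "'u \<Rightarrow> 'u \<Rightarrow> bool" where
  "transverse V W \<longleftrightarrow> V \<noteq> W \<and> \<not> V \<bottom> W \<and> \<not> V \<sqsubseteq> W \<and> \<not> W \<sqsubseteq> V"

definition dom_dist :: "'u \<Rightarrow> 'x \<Rightarrow> 'x \<Rightarrow> real" where
  "dom_dist U x y = mdist (C U) (\<pi> U x) (\<pi> U y)"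

definition dom_setdist :: "'u \<Rightarrow> 'x \<Rightarrow> 'c set \<Rightarrow> ennreal" where
  "dom_setdist U x A = msetdist (C U) {\<pi> U x} A"

end

text \<open>
  In \<open>large_links\<close> the domains $T_1,\dots,T_{\lfloor N\rfloor}$ form a possibly empty set of
  cardinality at most $\lfloor N\rfloor$: since $N \ge 1$, insisting on an actual $T_1$ would be
  contradictory when \<open>W\<close> is nest-minimal.  In \<open>bounded_geodesic_image\<close> it suffices to treat
  geodesic segments: a ray or line missing the neighbourhood is an increasing union of such segments.
\<close>

locale hhs = hhs_data X \<SS> E C \<pi> nest orth \<rho> \<rho>map
  for X :: "'x metric"
    and \<SS> :: "'u set"
    and E :: real
    and C :: "'u \<Rightarrow> 'c metric"
    and \<pi> :: "'u \<Rightarrow> 'x \<Rightarrow> 'c"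
    and nest :: "'u \<Rightarrow> 'u \<Rightarrow> bool"  (infix "\<sqsubseteq>" 50)
    and orth :: "'u \<Rightarrow> 'u \<Rightarrow> bool"  (infix "\<bottom>" 50)
    and \<rho> :: "'u \<Rightarrow> 'u \<Rightarrow> 'c set"
    and \<rho>map :: "'u \<Rightarrow> 'u \<Rightarrow> 'c \<Rightarrow> 'c set" +
  assumes quasigeodesic: "quasigeodesic_space X"
    and E_ge_1: "E \<ge> 1"
    and geodesic: "U \<in> \<SS> \<Longrightarrow> geodesic_space (C U)"
    and hyperbolic: "U \<in> \<SS> \<Longrightarrow> hyperbolic_space E (C U)"
    and proj_in: "U \<in> \<SS> \<Longrightarrow> \<pi> U \<in> mspace X \<rightarrow> mspace (C U)"
    and proj_coarse_lipschitz:
      "\<lbrakk>U \<in> \<SS>; x \<in> mspace X; y \<in> mspace X\<rbrakk> \<Longrightarrow> dom_dist U x y \<le> E * mdist X x y + E"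
    and proj_coarse_surj:
      "\<lbrakk>U \<in> \<SS>; p \<in> mspace (C U)\<rbrakk> \<Longrightarrow> msetdist (C U) {p} (\<pi> U ` mspace X) \<le> ennreal E"
    and nest_refl: "reflp_on \<SS> (\<sqsubseteq>)"
    and nest_antisym: "antisymp_on \<SS> (\<sqsubseteq>)"
    and nest_trans: "transp_on \<SS> (\<sqsubseteq>)"
    and nest_unique_maximal:
      "\<SS> \<noteq> {} \<Longrightarrow> \<exists>!M. M \<in> \<SS> \<and> (\<forall>U\<in>\<SS>. M \<sqsubseteq> U \<longrightarrow> U = M)"
    and rho_nest:
      "\<lbrakk>V \<in> \<SS>; W \<in> \<SS>; V \<sqsubset> W\<rbrakk> \<Longrightarrow>
        \<rho> V W \<noteq> {} \<and> \<rho> V W \<subseteq> mspace (C W) \<and> mdiam (C W) (\<rho> V W) \<le> ennreal E"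
    and rho_map:
      "\<lbrakk>V \<in> \<SS>; W \<in> \<SS>; V \<sqsubset> W\<rbrakk> \<Longrightarrow> \<rho>map W V \<in> mspace (C W) \<rightarrow> Pow (mspace (C V))"
    and orth_sym: "symp_on \<SS> (\<bottom>)"
    and orth_irrefl: "irreflp_on \<SS> (\<bottom>)"
    and orth_nest: "\<lbrakk>U \<in> \<SS>; V \<in> \<SS>; W \<in> \<SS>; V \<sqsubseteq> W; W \<bottom> U\<rbrakk> \<Longrightarrow> V \<bottom> U"
    and orth_incomparable: "\<lbrakk>V \<in> \<SS>; W \<in> \<SS>; V \<bottom> W\<rbrakk> \<Longrightarrow> \<not> V \<sqsubseteq> W \<and> \<not> W \<sqsubseteq> V"
    and containers:
      "\<lbrakk>T \<in> \<SS>; U \<in> \<SS>; U \<sqsubseteq> T; {V \<in> \<SS>. V \<sqsubseteq> T \<and> V \<bottom> U} \<noteq> {}\<rbrakk> \<Longrightarrow>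
        \<exists>W\<in>\<SS>. W \<sqsubset> T \<and> (\<forall>V\<in>\<SS>. V \<sqsubseteq> T \<and> V \<bottom> U \<longrightarrow> V \<sqsubseteq> W)"
    and rho_transverse:
      "\<lbrakk>V \<in> \<SS>; W \<in> \<SS>; transverse V W\<rbrakk> \<Longrightarrow>
        \<rho> V W \<noteq> {} \<and> \<rho> V W \<subseteq> mspace (C W) \<and> mdiam (C W) (\<rho> V W) \<le> ennreal E"
    and consistency_transverse:
      "\<lbrakk>V \<in> \<SS>; W \<in> \<SS>; transverse V W; x \<in> mspace X\<rbrakk> \<Longrightarrow>
        min (dom_setdist W x (\<rho> V W)) (dom_setdist V x (\<rho> W V)) \<le> ennreal E"
    and consistency_nest:
      "\<lbrakk>V \<in> \<SS>; W \<in> \<SS>; V \<sqsubset> W; x \<in> mspace X\<rbrakk> \<Longrightarrow>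
        min (dom_setdist W x (\<rho> V W)) (mdiam (C V) ({\<pi> V x} \<union> \<rho>map W V (\<pi> W x))) \<le> ennreal E"
    and consistency_rho:
      "\<lbrakk>U \<in> \<SS>; V \<in> \<SS>; W \<in> \<SS>; U \<sqsubseteq> V; V \<sqsubset> W \<or> (transverse V W \<and> \<not> W \<bottom> U)\<rbrakk> \<Longrightarrow>
        msetdist (C W) (\<rho> U W) (\<rho> V W) \<le> ennreal E"
    and finite_complexity:
      "\<exists>n. \<forall>K\<subseteq>\<SS>. (\<forall>U\<in>K. \<forall>V\<in>K. U \<sqsubseteq> V \<or> V \<sqsubseteq> U) \<longrightarrow> finite K \<and> card K \<le> n"
    and large_links:
      "\<lbrakk>W \<in> \<SS>; x \<in> mspace X; x' \<in> mspace X; N = E * dom_dist W x x' + E\<rbrakk> \<Longrightarrow>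
        \<exists>\<T>\<subseteq>{T \<in> \<SS>. T \<sqsubset> W}. finite \<T> \<and> int (card \<T>) \<le> \<lfloor>N\<rfloor> \<and>
          (\<forall>T\<in>\<SS>. T \<sqsubset> W \<longrightarrow> (\<exists>T'\<in>\<T>. T \<sqsubseteq> T') \<or> dom_dist T x x' < E) \<and>
          (\<forall>T\<in>\<T>. dom_setdist W x (\<rho> T W) \<le> ennreal N)"
    and bounded_geodesic_image:
      "\<lbrakk>V \<in> \<SS>; W \<in> \<SS>; V \<sqsubset> W; geodesic_segment (C W) a b \<gamma>\<rbrakk> \<Longrightarrow>
        mdiam (C V) (\<Union>r\<in>\<gamma>. \<rho>map W V r) \<le> ennreal E \<or>
        (\<exists>r\<in>\<gamma>. msetdist (C W) {r} (\<rho> V W) \<le> ennreal E)"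
    and bounded_geodesic_image_points:
      "\<lbrakk>V \<in> \<SS>; W \<in> \<SS>; V \<sqsubset> W; y \<in> mspace X; z \<in> mspace X; dom_dist V y z > E;
        geodesic_segment (C W) (\<pi> W y) (\<pi> W z) \<gamma>\<rbrakk> \<Longrightarrow>
        msetdist (C W) (\<rho> V W) \<gamma> \<le> ennreal E"
    and partial_realisation:
      "\<lbrakk>\<W> \<subseteq> \<SS>; pairwise (\<bottom>) \<W>; \<And>W. W \<in> \<W> \<Longrightarrow> pt W \<in> mspace (C W)\<rbrakk> \<Longrightarrow>
        \<exists>x\<in>mspace X.
          (\<forall>W\<in>\<W>. mdist (C W) (\<pi> W x) (pt W) \<le> E) \<and>
          (\<forall>W\<in>\<W>. \<forall>V\<in>\<SS>. W \<sqsubset> V \<or> transverse W V \<longrightarrow> dom_setdist V x (\<rho> W V) \<le> ennreal E)"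
    and uniqueness:
      "\<exists>\<theta>::real. \<forall>x\<in>mspace X. \<forall>y\<in>mspace X.
        mdist X x y > \<theta> \<longrightarrow> (\<exists>U\<in>\<SS>. dom_dist U x y > \<kappa>)"


section \<open>Hierarchically hyperbolic groups\<close>

text \<open>
  \<open>A\<close> is the finite generating set defining the word metric.  The map \<open>isom g U\<close> is the isometry
  \<open>C U \<rightarrow> C (act g U)\<close>.  Equivariance is only required of the sets \<open>\<rho> V U\<close>, not of the maps
  \<open>\<rho>map\<close>.
\<close>

locale hhg = group G + hhs "word_metric G A" \<SS> E C \<pi> nest orth \<rho> \<rho>map
  for G :: "('g, 'b) monoid_scheme"  (structure)
    and A :: "'g set"
    and \<SS> :: "'u set"
    and E :: real
    and C :: "'u \<Rightarrow> 'c metric"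
    and \<pi> :: "'u \<Rightarrow> 'g \<Rightarrow> 'c"
    and nest :: "'u \<Rightarrow> 'u \<Rightarrow> bool"  (infix "\<sqsubseteq>" 50)
    and orth :: "'u \<Rightarrow> 'u \<Rightarrow> bool"  (infix "\<bottom>" 50)
    and \<rho> :: "'u \<Rightarrow> 'u \<Rightarrow> 'c set"
    and \<rho>map :: "'u \<Rightarrow> 'u \<Rightarrow> 'c \<Rightarrow> 'c set" +
  fixes act :: "'g \<Rightarrow> 'u \<Rightarrow> 'u"
    and isom :: "'g \<Rightarrow> 'u \<Rightarrow> 'c \<Rightarrow> 'c"
  assumes gens_finite: "finite A"
    and gens_in: "A \<subseteq> carrier G"
    and gens_generate: "generate G A = carrier G"
    and action: "group_action G \<SS> act"
    and cofinite: "finite (orbits G \<SS> act)"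
    and act_nest: "\<lbrakk>g \<in> carrier G; U \<in> \<SS>; V \<in> \<SS>\<rbrakk> \<Longrightarrow> act g U \<sqsubseteq> act g V \<longleftrightarrow> U \<sqsubseteq> V"
    and act_orth: "\<lbrakk>g \<in> carrier G; U \<in> \<SS>; V \<in> \<SS>\<rbrakk> \<Longrightarrow> act g U \<bottom> act g V \<longleftrightarrow> U \<bottom> V"
    and act_transverse:
      "\<lbrakk>g \<in> carrier G; U \<in> \<SS>; V \<in> \<SS>\<rbrakk> \<Longrightarrow> transverse (act g U) (act g V) \<longleftrightarrow> transverse U V"
    and iso_bij:
      "\<lbrakk>g \<in> carrier G; U \<in> \<SS>\<rbrakk> \<Longrightarrow> bij_betw (isom g U) (mspace (C U)) (mspace (C (act g U)))"
    and iso_dist: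
      "\<lbrakk>g \<in> carrier G; U \<in> \<SS>; p \<in> mspace (C U); q \<in> mspace (C U)\<rbrakk> \<Longrightarrow>
        mdist (C (act g U)) (isom g U p) (isom g U q) = mdist (C U) p q"
    and iso_mult:
      "\<lbrakk>g \<in> carrier G; h \<in> carrier G; U \<in> \<SS>; p \<in> mspace (C U)\<rbrakk> \<Longrightarrow>
        isom (g \<otimes> h) U p = isom g (act h U) (isom h U p)"
    and proj_equivariant:
      "\<lbrakk>g \<in> carrier G; x \<in> carrier G; U \<in> \<SS>\<rbrakk> \<Longrightarrow> isom g U (\<pi> U x) = \<pi> (act g U) (g \<otimes> x)"
    and rho_equivariant:
      "\<lbrakk>g \<in> carrier G; U \<in> \<SS>; V \<in> \<SS>; transverse U V \<or> V \<sqsubset> U\<rbrakk> \<Longrightarrow>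
        isom g U ` \<rho> V U = \<rho> (act g V) (act g U)"
    and E_diam:
      "\<lbrakk>U \<in> \<SS>; mdiam (C U) (mspace (C U)) > ennreal E\<rbrakk> \<Longrightarrow> mdiam (C U) (mspace (C U)) = \<infinity>"

definition unbounded_domains :: "'u set \<Rightarrow> ('u \<Rightarrow> 'c metric) \<Rightarrow> 'u set" where
  "unbounded_domains \<SS> C =
     {U \<in> \<SS>. \<not> Metric_space.mbounded (mspace (C U)) (mdist (C U)) (mspace (C U))}"

end

theory Submission
  imports Defs
begin

text \<open>
  The candidates for the finite set are forced: they are the \<open>\<sqsubseteq>\<close>-maximal unbounded domains, which
  every unbounded domain lies below because chains are finite, and which the group permutes. Pairwise
  orthogonal families are finite, because containers turn an infinite one into an infinite descending
  chain (\<open>pairwise_orth_finite\<close>). So the content is that two distinct maximal unbounded domains are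
  never transverse.

  Two opposing facts exclude transversality. On one side, for any two group elements \<open>x\<close>, \<open>y\<close> the
  number of maximal unbounded domains in which \<open>x\<close> and \<open>y\<close> are more than \<open>E\<close> apart is bounded
  independently of \<open>x\<close> and \<open>y\<close> (\<open>relevant_below_bounded\<close>): descend from the
  top domain by large links. As long as the current domain is bounded, its diameter is at most \<open>E\<close>, so
  large links offers only boundedly many domains one level down; and as soon as the current domain is
  unbounded, it is itself the only maximal unbounded domain below it.

  On the other side, suppose that \<open>U\<close> and \<open>V\<close> are maximal unbounded and transverse. Then the sets
  $\rho^W_V$, over all maximal unbounded \<open>W\<close> transverse to \<open>V\<close>, are unbounded in \<open>C V\<close>
  (\<open>transverse_far_away\<close>). For this, realise points of \<open>C V\<close> by group elements \<open>x\<close> in the product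
  region of \<open>V\<close>, and consider the domains \<open>x\<^sup>-\<^sup>1V\<close>. If \<open>x\<^sup>-\<^sup>1V\<close> and \<open>y\<^sup>-\<^sup>1V\<close> are
  transverse, then so are \<open>xy\<^sup>-\<^sup>1V\<close> and \<open>V\<close>, and $\rho^{xy^{-1}V}_V$ is close to \<open>x\<close>. If this
  never happens for \<open>x\<close>, \<open>y\<close> far out, the domains \<open>x\<^sup>-\<^sup>1V\<close> are pairwise equal or orthogonal, so there
  are finitely many of them, and coincidences \<open>x\<^sup>-\<^sup>1V = y\<^sup>-\<^sup>1V\<close> give elements \<open>yx\<^sup>-\<^sup>1\<close> of the
  stabiliser of \<open>V\<close> that move $\rho^U_V$ arbitrarily far.

  Hence there is an infinite sequence of maximal unbounded domains, consecutive ones transverse, such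
  that in each of them the projections of its predecessor and its successor are far apart. Consistency
  propagates along such a sequence: a point that in one domain is far from the successor projects, in
  every later domain, close to the predecessor. It follows that the members of
  the sequence are distinct, and that two suitable points at the two ends of a long stretch are far
  apart in all domains in between (\<open>transverse_chain_many_relevant\<close>), contradicting the uniform bound.
\<close>

section \<open>Distances between points and bounded sets\<close>

lemma mdist_le_of_mdiam_le:
  assumes "mdiam m A \<le> ennreal D" "0 \<le> D" "x \<in> A" "y \<in> A"
  shows "mdist m x y \<le> D"
proof -
  have "ennreal (mdist m x y) \<le> mdiam m A"
    unfolding mdiam_def using assms(3,4) by (meson SUP_upper2 order_refl)
  also note assms(1)
  finally show ?thesis using assms(2) by simp
qed

lemma msetdist_singleton_leE:
  assumes "msetdist m {p} B \<le> ennreal D" "0 \<le> D"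
  obtains b where "b \<in> B" "mdist m p b \<le> D + 1"
proof -
  have "msetdist m {p} B < ennreal (D + 1)"
    using assms by (intro order.strict_trans1[OF assms(1)]) (simp add: ennreal_less_iff)
  then have "\<exists>b\<in>B. ennreal (mdist m p b) < ennreal (D + 1)"
    by (simp add: msetdist_def INF_less_iff)
  then show ?thesis using that by (auto simp: ennreal_less_iff)
qed

lemma unbounded_domain_iff:
  "U \<in> unbounded_domains \<SS> C \<longleftrightarrow>
     U \<in> \<SS> \<and> (\<forall>B. \<exists>p\<in>mspace (C U). \<exists>q\<in>mspace (C U). mdist (C U) p q > B)"
  by (simp add: unbounded_domains_def Metric_space.mbounded_alt[OF Metric_space_mspace_mdist]
      not_le)

lemma unbounded_domain_far_point:
  assumes "U \<in> unbounded_domains \<SS> C" "a \<in> mspace (C U)"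
  obtains p where "p \<in> mspace (C U)" "mdist (C U) a p > B"
proof -
  have "\<not> mspace (C U) \<subseteq> Metric_space.mcball (mspace (C U)) (mdist (C U)) a B"
    using assms(1) by (auto simp: unbounded_domains_def
        Metric_space.mbounded_def[OF Metric_space_mspace_mdist])
  then show ?thesis
    using assms(2) that
    by (force simp: Metric_space.in_mcball[OF Metric_space_mspace_mdist] not_le)
qed


section \<open>Height of a domain\<close>

context hhs
begin

definition height :: "'u \<Rightarrow> nat" where
  "height T = Max (card ` {K. K \<subseteq> {V\<in>\<SS>. V \<sqsubseteq> T} \<and> (\<forall>U\<in>K. \<forall>V\<in>K. U \<sqsubseteq> V \<or> V \<sqsubseteq> U)})"

lemma nest_transD: "\<lbrakk>U \<sqsubseteq> V; V \<sqsubseteq> W; U \<in> \<SS>; V \<in> \<SS>; W \<in> \<SS>\<rbrakk> \<Longrightarrow> U \<sqsubseteq> W"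
  using nest_trans by (meson transp_onD)

lemma nest_antisymD: "\<lbrakk>U \<sqsubseteq> V; V \<sqsubseteq> U; U \<in> \<SS>; V \<in> \<SS>\<rbrakk> \<Longrightarrow> U = V"
  using nest_antisym by (meson antisymp_onD)

lemma nest_reflD: "U \<in> \<SS> \<Longrightarrow> U \<sqsubseteq> U"
  using nest_refl by (meson reflp_onD)

lemma orth_symD: "\<lbrakk>U \<bottom> V; U \<in> \<SS>; V \<in> \<SS>\<rbrakk> \<Longrightarrow> V \<bottom> U"
  using orth_sym by (meson symp_onD)

lemma height_bounded: "\<exists>n. \<forall>T. height T \<le> n"
proof -
  obtain n where n: "K \<subseteq> \<SS> \<Longrightarrow> \<forall>U\<in>K. \<forall>V\<in>K. U \<sqsubseteq> V \<or> V \<sqsubseteq> U \<Longrightarrow> card K \<le> n" for K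
    using finite_complexity by metis
  have "height T \<le> n" for T
  proof -
    let ?c = "card ` {K. K \<subseteq> {V\<in>\<SS>. V \<sqsubseteq> T} \<and> (\<forall>U\<in>K. \<forall>V\<in>K. U \<sqsubseteq> V \<or> V \<sqsubseteq> U)}"
    have "?c \<subseteq> {..n}" by (force intro: n)
    moreover have "?c \<noteq> {}" by blast
    ultimately show ?thesis
      unfolding height_def by (subst Max_le_iff) (auto intro: finite_subset)
  qed
  then show ?thesis by blast
qed

lemma height_strict_mono:
  assumes "V \<sqsubset> T" "V \<in> \<SS>" "T \<in> \<SS>"
  shows "height V < height T"
proof -
  let ?chains = "\<lambda>T. {K. K \<subseteq> {V\<in>\<SS>. V \<sqsubseteq> T} \<and> (\<forall>U\<in>K. \<forall>V\<in>K. U \<sqsubseteq> V \<or> V \<sqsubseteq> U)}"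
  obtain n where n: "K \<subseteq> \<SS> \<Longrightarrow> \<forall>U\<in>K. \<forall>V\<in>K. U \<sqsubseteq> V \<or> V \<sqsubseteq> U \<Longrightarrow>
      finite K \<and> card K \<le> n" for K
    using finite_complexity by metis
  have fin: "finite (card ` ?chains T)" for T
  proof (rule finite_subset)
    show "card ` ?chains T \<subseteq> {..n}" by (auto intro!: n[THEN conjunct2])
  qed simp
  have "card ` ?chains V \<noteq> {}" by blast
  then have "height V \<in> card ` ?chains V"
    unfolding height_def using fin Max_in by blast
  then obtain K where K: "K \<in> ?chains V" "height V = card K" by blast
  have nest: "V \<sqsubseteq> T" "V \<noteq> T" using assms(1) by (auto simp: pnest_def)
  have "T \<notin> K" using K(1) nest nest_antisymD assms(2,3) by blast
  moreover have "finite K" using K(1) by (intro n[THEN conjunct1]) auto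
  moreover have "insert T K \<in> ?chains T"
    using K(1) nest nest_reflD[of T] nest_transD[of _ V T] assms(2,3) by blast
  then have "card (insert T K) \<le> height T"
    unfolding height_def by (intro Max_ge fin imageI)
  ultimately show ?thesis using K(2) by simp
qed

lemma nested_in_maximal:
  assumes "P U" "U \<in> \<SS>"
  obtains W where "P W" "W \<in> \<SS>" "U \<sqsubseteq> W" "\<And>V. \<lbrakk>P V; V \<in> \<SS>; W \<sqsubseteq> V\<rbrakk> \<Longrightarrow> V = W"
proof -
  obtain n where n: "height T \<le> n" for T using height_bounded by blast
  let ?Q = "\<lambda>W. P W \<and> W \<in> \<SS> \<and> U \<sqsubseteq> W"
  have "?Q U" using assms nest_reflD by blast
  then have "\<exists>W. ?Q W \<and> (\<forall>V. ?Q V \<longrightarrow> height V \<le> height W)"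
    by (rule ex_has_greatest_nat[where b = "Suc n"]) (simp add: n le_imp_less_Suc)
  then obtain W where W: "?Q W" "\<And>V. ?Q V \<Longrightarrow> height V \<le> height W"
    by (elim exE conjE) simp
  have "V = W" if V: "P V" "V \<in> \<SS>" "W \<sqsubseteq> V" for V
  proof (rule ccontr)
    assume "V \<noteq> W"
    then have "height W < height V"
      using V W(1) by (intro height_strict_mono) (auto simp: pnest_def)
    moreover have "?Q V" using V W(1) assms(2) nest_transD by blast
    ultimately show False using W(2)[of V] by simp
  qed
  with W(1) that show ?thesis by blast
qed

lemma top_domain:
  assumes "\<SS> \<noteq> {}"
  obtains S where "S \<in> \<SS>" "\<And>U. U \<in> \<SS> \<Longrightarrow> U \<sqsubseteq> S"
proof -
  obtain S where S: "S \<in> \<SS>" "\<And>M. \<lbrakk>M \<in> \<SS>; \<forall>U\<in>\<SS>. M \<sqsubseteq> U \<longrightarrow> U = M\<rbrakk> \<Longrightarrow> M = S"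
    using nest_unique_maximal[OF assms] by blast
  have "U \<sqsubseteq> S" if "U \<in> \<SS>" for U
    using nested_in_maximal[of "\<lambda>_. True" U] S(2) that by metis
  with S(1) that show ?thesis by blast
qed

text \<open>
  Choose a member \<open>U\<close> of the family: the others all lie in a container of \<open>U\<close>, which
  has smaller height.
\<close>
lemma pairwise_orth_finite:
  assumes "\<W> \<subseteq> \<SS>" "pairwise (\<bottom>) \<W>"
  shows "finite \<W>"
proof -
  have below: "finite \<W>" if "T \<in> \<SS>" "\<W> \<subseteq> {V\<in>\<SS>. V \<sqsubseteq> T}" "pairwise (\<bottom>) \<W>" for T \<W>
    using that
  proof (induction "height T" arbitrary: T \<W> rule: less_induct)
    case less
    show ?case
    proof (cases "\<exists>U V. U \<in> \<W> \<and> V \<in> \<W> \<and> U \<noteq> V")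
      case False
      then show ?thesis
        by (metis finite.emptyI finite_insert insertI1 is_singletonI' is_singleton_def)
    next
      case True
      then obtain U V where UV: "U \<in> \<W>" "V \<in> \<W>" "U \<noteq> V" by blast
      have orthU: "V' \<bottom> U" if "V' \<in> \<W> - {U}" for V'
        using less.prems(3) UV(1) that by (auto simp: pairwise_def)
      have U: "U \<in> \<SS>" "U \<sqsubseteq> T" using less.prems(2) UV(1) by auto
      have "{V \<in> \<SS>. V \<sqsubseteq> T \<and> V \<bottom> U} \<noteq> {}"
        using orthU[of V] UV less.prems(2) by auto
      then obtain W where W: "W \<in> \<SS>" "W \<sqsubset> T" "\<And>V. \<lbrakk>V \<in> \<SS>; V \<sqsubseteq> T; V \<bottom> U\<rbrakk> \<Longrightarrow> V \<sqsubseteq> W"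
        using containers[OF less.prems(1) U] by blast
      have "finite (\<W> - {U})"
      proof (rule less.hyps)
        show "height W < height T" using W less.prems(1) by (intro height_strict_mono)
        show "\<W> - {U} \<subseteq> {V \<in> \<SS>. V \<sqsubseteq> W}" using W(3) orthU less.prems(2) by blast
        show "pairwise (\<bottom>) (\<W> - {U})" using less.prems(3) by (rule pairwise_subset) blast
      qed (rule W(1))
      then show ?thesis by simp
    qed
  qed
  show ?thesis
  proof (cases "\<SS> = {}")
    case False
    then obtain S where "S \<in> \<SS>" "\<And>U. U \<in> \<SS> \<Longrightarrow> U \<sqsubseteq> S" using top_domain by blast
    then show ?thesis using below[of S \<W>] assms by blast
  qed (use assms in simp)
qed


section \<open>Chains of transverse domains\<close>

lemma transverse_sym: "\<lbrakk>transverse U V; U \<in> \<SS>; V \<in> \<SS>\<rbrakk> \<Longrightarrow> transverse V U"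
  using orth_symD unfolding transverse_def by blast

text \<open>
  The slack of 1 makes up for the infimal distance to \<open>\<rho> V W\<close> not being attained in general.
\<close>
definition near_rho :: "'u \<Rightarrow> 'u \<Rightarrow> 'x \<Rightarrow> bool" where
  "near_rho V W x \<longleftrightarrow> (\<exists>a\<in>\<rho> V W. mdist (C W) (\<pi> W x) a \<le> E + 1)"

text \<open>
  The threshold leaves a distance of more than \<open>E\<close> after subtracting a distance \<open>E + 1\<close> at both
  ends, so that points that are near the two sets count as far apart in \<open>V\<close>.
\<close>
definition separated :: "'u \<Rightarrow> 'u \<Rightarrow> 'u \<Rightarrow> bool" where
  "separated U V W \<longleftrightarrow> (\<forall>a\<in>\<rho> U V. \<forall>b\<in>\<rho> W V. mdist (C V) a b > 3 * E + 2)"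

definition transverse_chain :: "(nat \<Rightarrow> 'u) \<Rightarrow> bool" where
  "transverse_chain f \<longleftrightarrow> (\<forall>i. f i \<in> \<SS> \<and> transverse (f i) (f (Suc i)) \<and>
     separated (f i) (f (Suc i)) (f (Suc (Suc i))))"

lemma near_rhoI:
  assumes "dom_setdist W x (\<rho> V W) \<le> ennreal E"
  shows "near_rho V W x"
  using assms E_ge_1 unfolding dom_setdist_def near_rho_def
  by (meson msetdist_singleton_leE order_trans zero_le_one)

lemma near_rho_consistency:
  assumes "V \<in> \<SS>" "W \<in> \<SS>" "transverse V W" "x \<in> mspace X"
  shows "near_rho V W x \<or> near_rho W V x"
  using consistency_transverse[OF assms] near_rhoI by (auto simp: min_le_iff_disj)

lemma proj_mspace: "\<lbrakk>U \<in> \<SS>; x \<in> mspace X\<rbrakk> \<Longrightarrow> \<pi> U x \<in> mspace (C U)"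
  using proj_in by blast

lemma rho_transverse_bounded:
  assumes "transverse V W" "V \<in> \<SS>" "W \<in> \<SS>"
  shows "\<rho> V W \<noteq> {}" "\<rho> V W \<subseteq> mspace (C W)"
    "\<lbrakk>a \<in> \<rho> V W; b \<in> \<rho> V W\<rbrakk> \<Longrightarrow> mdist (C W) a b \<le> E"
  using rho_transverse[OF assms(2,3,1)] mdist_le_of_mdiam_le E_ge_1 by fastforce+

lemma separated_far:
  assumes "transverse U V" "transverse W V" "U \<in> \<SS>" "V \<in> \<SS>" "W \<in> \<SS>"
    and "separated U V W" "near_rho U V x" "near_rho W V y" "x \<in> mspace X" "y \<in> mspace X"
  shows "dom_dist V x y > E"
proof -
  obtain a b where ab: "a \<in> \<rho> U V" "mdist (C V) (\<pi> V x) a \<le> E + 1"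
      "b \<in> \<rho> W V" "mdist (C V) (\<pi> V y) b \<le> E + 1"
    using assms(7,8) by (auto simp: near_rho_def)
  have [simp]: "a \<in> mspace (C V)" "b \<in> mspace (C V)" "\<pi> V x \<in> mspace (C V)" "\<pi> V y \<in> mspace (C V)"
    using ab rho_transverse_bounded(2) assms proj_mspace by blast+
  have "3 * E + 2 < mdist (C V) a b" using assms(6) ab by (auto simp: separated_def)
  also have "\<dots> \<le> mdist (C V) a (\<pi> V x) + mdist (C V) (\<pi> V x) (\<pi> V y) + mdist (C V) (\<pi> V y) b"
    using mdist_triangle[of a "C V" "\<pi> V x" b] mdist_triangle[of "\<pi> V x" "C V" "\<pi> V y" b] by simp
  finally show ?thesis
    using ab by (simp add: dom_dist_def mdist_commute[of _ a])
qed

lemma separated_not_near: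
  assumes "transverse U V" "transverse W V" "U \<in> \<SS>" "V \<in> \<SS>" "W \<in> \<SS>"
    and "separated U V W" "near_rho U V x" "x \<in> mspace X"
  shows "\<not> near_rho W V x"
proof
  assume "near_rho W V x"
  then have "dom_dist V x x > E" using separated_far[of U V W x x] assms by blast
  moreover have "dom_dist V x x = 0"
    using proj_mspace[OF assms(4,8)] by (simp add: dom_dist_def)
  ultimately show False using E_ge_1 by simp
qed

lemma separated_sym:
  assumes "separated U V W"
  shows "separated W V U"
  using assms unfolding separated_def by (metis mdist_commute)

lemma transverse_chainD:
  assumes "transverse_chain f"
  shows "f i \<in> \<SS>" "transverse (f i) (f (Suc i))" "transverse (f (Suc i)) (f i)"
    "separated (f i) (f (Suc i)) (f (Suc (Suc i)))"
  using assms transverse_sym by (auto simp: transverse_chain_def)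

text \<open>
  A point far from the successor of \<open>f k\<close> is near \<open>f k\<close> in the successor, by consistency; there,
  separation makes it far from the successor of the successor, and so on up the chain. The next lemma
  is the same argument in the opposite direction.
\<close>
lemma transverse_chain_forward:
  assumes f: "transverse_chain f" and x: "x \<in> mspace X"
    and "\<not> near_rho (f (Suc k)) (f k) x" "k \<le> i"
  shows "near_rho (f i) (f (Suc i)) x"
  using assms(4,3)
proof (induction i rule: dec_induct)
  case base
  then show ?case
    using near_rho_consistency[of "f k" "f (Suc k)" x] transverse_chainD[OF f] x by blast
next
  case (step i)
  then have "\<not> near_rho (f (Suc (Suc i))) (f (Suc i)) x"
    using separated_not_near[of "f i" "f (Suc i)" "f (Suc (Suc i))" x] transverse_chainD[OF f] x
    by blast
  then show ?case
    using near_rho_consistency[of "f (Suc i)" "f (Suc (Suc i))" x] transverse_chainD[OF f] x by blast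
qed

lemma transverse_chain_backward:
  assumes f: "transverse_chain f" and x: "x \<in> mspace X"
    and "\<not> near_rho (f k) (f (Suc k)) x" "i \<le> k"
  shows "near_rho (f (Suc i)) (f i) x"
  using assms(4,3)
proof (induction i rule: inc_induct)
  case base
  then show ?case
    using near_rho_consistency[of "f k" "f (Suc k)" x] transverse_chainD[OF f] x by blast
next
  case (step i)
  then have "\<not> near_rho (f i) (f (Suc i)) x"
    using separated_not_near[of "f (Suc (Suc i))" "f (Suc i)" "f i" x] separated_sym
      transverse_chainD[OF f] x by blast
  then show ?case
    using near_rho_consistency[of "f i" "f (Suc i)" x] transverse_chainD[OF f] x by blast
qed

lemma point_far_from_two_rho:
  assumes V: "V \<in> unbounded_domains \<SS> C"
    and U: "transverse U V" "U \<in> \<SS>" and W: "transverse W V" "W \<in> \<SS>"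
  obtains x where "x \<in> mspace X" "\<not> near_rho U V x" "\<not> near_rho W V x"
proof -
  have VS: "V \<in> \<SS>" using V by (simp add: unbounded_domains_def)
  note rhoU = rho_transverse_bounded[OF U(1,2) VS] and rhoW = rho_transverse_bounded[OF W(1,2) VS]
  obtain a b where ab: "a \<in> \<rho> U V" "b \<in> \<rho> W V" using rhoU(1) rhoW(1) by blast
  have m: "a \<in> mspace (C V)" "b \<in> mspace (C V)" using ab rhoU(2) rhoW(2) by blast+
  obtain p where p: "p \<in> mspace (C V)" "mdist (C V) a p > mdist (C V) a b + 3 * E + 2"
    using unbounded_domain_far_point[OF V m(1)] by blast
  have "0 \<le> E" using E_ge_1 by simp
  then obtain c where "c \<in> \<pi> V ` mspace X" "mdist (C V) p c \<le> E + 1"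
    by (rule msetdist_singleton_leE[OF proj_coarse_surj[OF VS p(1)]])
  then obtain x where x: "x \<in> mspace X" "mdist (C V) p (\<pi> V x) \<le> E + 1"
    by blast
  have px: "\<pi> V x \<in> mspace (C V)" by (rule proj_mspace[OF VS x(1)])
  have far: "mdist (C V) c p \<le> 3 * E + 2"
    if "c' \<in> R" "mdist (C V) (\<pi> V x) c' \<le> E + 1" "R \<subseteq> mspace (C V)" "c \<in> R"
      "\<And>a b. \<lbrakk>a \<in> R; b \<in> R\<rbrakk> \<Longrightarrow> mdist (C V) a b \<le> E" for c c' R
  proof -
    have c: "c \<in> mspace (C V)" "c' \<in> mspace (C V)" using that by blast+
    have "mdist (C V) c p \<le> mdist (C V) c c' + mdist (C V) c' p"
      using c p(1) by (intro mdist_triangle)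
    also have "mdist (C V) c' p \<le> mdist (C V) c' (\<pi> V x) + mdist (C V) (\<pi> V x) p"
      using c p(1) px by (intro mdist_triangle)
    finally show ?thesis
      using that(2) that(5)[OF that(4,1)] x(2)
      by (simp add: mdist_commute[of _ c' "\<pi> V x"] mdist_commute[of _ "\<pi> V x" p])
  qed
  show ?thesis
  proof (rule that[OF x(1)])
    show "\<not> near_rho U V x"
    proof
      assume "near_rho U V x"
      then have "mdist (C V) a p \<le> 3 * E + 2"
        unfolding near_rho_def using far rhoU(2,3) ab(1) by blast
      then show False using p(2) mdist_nonneg[of "C V" a b] by linarith
    qed
    show "\<not> near_rho W V x"
    proof
      assume "near_rho W V x"
      then have "mdist (C V) b p \<le> 3 * E + 2"
        unfolding near_rho_def using far rhoW(2,3) ab(2) by blast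
      then show False using p(2) mdist_triangle[OF m p(1)] by linarith
    qed
  qed
qed

text \<open>
  If \<open>f j = f k\<close> for some \<open>j > k\<close>, take a point that in this domain is far from both \<open>f (k + 1)\<close> and
  \<open>f (j - 1)\<close>. Being far from \<open>f (k + 1)\<close> in \<open>f k\<close>, it would have to be near \<open>f (j - 1)\<close> in \<open>f j\<close>.
\<close>
lemma transverse_chain_inj:
  assumes f: "transverse_chain f" and ub: "\<And>i. f i \<in> unbounded_domains \<SS> C"
  shows "inj f"
proof (rule linorder_injI)
  fix k j :: nat assume "k < j"
  then obtain i where j: "j = Suc i" and i: "k \<le> i" by (metis less_Suc_eq_le lessE nat_less_le)
  show "f k \<noteq> f j"
  proof
    assume eq: "f k = f j"
    have "transverse (f i) (f k)" using transverse_chainD(2)[OF f, of i] eq j by simp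
    then obtain x where "x \<in> mspace X" "\<not> near_rho (f (Suc k)) (f k) x" "\<not> near_rho (f i) (f k) x"
      using point_far_from_two_rho[OF ub, of "f (Suc k)" k "f i"] transverse_chainD(1,3)[OF f]
      by blast
    then show False using transverse_chain_forward[OF f, of x k i] i eq j by simp
  qed
qed

lemma transverse_chain_many_relevant:
  assumes f: "transverse_chain f" and ub: "\<And>i. f i \<in> unbounded_domains \<SS> C"
  obtains x y where "x \<in> mspace X" "y \<in> mspace X" "\<And>i. \<lbrakk>0 < i; i \<le> n\<rbrakk> \<Longrightarrow> dom_dist (f i) x y > E"
proof -
  note D = transverse_chainD[OF f]
  obtain x where x: "x \<in> mspace X" "\<not> near_rho (f (Suc 0)) (f 0) x"
    using point_far_from_two_rho[OF ub] D(1,3) by metis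
  obtain y where y: "y \<in> mspace X" "\<not> near_rho (f n) (f (Suc n)) y"
    using point_far_from_two_rho[OF ub] D(1,2) by metis
  have "dom_dist (f i) x y > E" if i: "0 < i" "i \<le> n" for i
  proof -
    obtain l where l: "i = Suc l" using i(1) by (cases i) auto
    have "near_rho (f l) (f (Suc l)) x" by (rule transverse_chain_forward[OF f x]) simp
    moreover have "near_rho (f (Suc (Suc l))) (f (Suc l)) y"
      by (rule transverse_chain_backward[OF f y]) (use i l in simp)
    ultimately show ?thesis
      using separated_far[of "f l" "f (Suc l)" "f (Suc (Suc l))" x y] D x(1) y(1) l by blast
  qed
  with x(1) y(1) that show ?thesis by blast
qed

end


section \<open>Maximal unbounded domains of a group\<close>

context hhg
begin

lemma mspace_word [simp]: "mspace (word_metric G A) = carrier G"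
  using word_metric_simps(1)[OF gens_in gens_generate] .

lemma act_closed: "\<lbrakk>g \<in> carrier G; U \<in> \<SS>\<rbrakk> \<Longrightarrow> act g U \<in> \<SS>"
  using group_action.element_image[OF action] by blast

lemma act_mult: "\<lbrakk>g \<in> carrier G; h \<in> carrier G; U \<in> \<SS>\<rbrakk> \<Longrightarrow> act (g \<otimes> h) U = act g (act h U)"
  using group_action.composition_rule[OF action] by blast

lemma act_inv_act: "\<lbrakk>g \<in> carrier G; U \<in> \<SS>\<rbrakk> \<Longrightarrow> act (inv g) (act g U) = U"
  using group_action.orbit_sym_aux[OF action] by blast

lemma act_act_inv: "\<lbrakk>g \<in> carrier G; U \<in> \<SS>\<rbrakk> \<Longrightarrow> act g (act (inv g) U) = U"
  using act_inv_act[of "inv g" U] by simp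

lemma unbounded_domains_subset: "U \<in> unbounded_domains \<SS> C \<Longrightarrow> U \<in> \<SS>"
  by (simp add: unbounded_domains_def)

lemma act_unbounded:
  assumes g: "g \<in> carrier G" and U: "U \<in> unbounded_domains \<SS> C"
  shows "act g U \<in> unbounded_domains \<SS> C"
  unfolding unbounded_domain_iff
proof (intro conjI allI)
  have US: "U \<in> \<SS>" using U by (rule unbounded_domains_subset)
  then show "act g U \<in> \<SS>" using g by (intro act_closed)
  fix B
  have "\<exists>p\<in>mspace (C U). \<exists>q\<in>mspace (C U). mdist (C U) p q > B"
    using U unfolding unbounded_domain_iff by simp
  then obtain p q where pq: "p \<in> mspace (C U)" "q \<in> mspace (C U)" "mdist (C U) p q > B"
    by blast
  show "\<exists>p\<in>mspace (C (act g U)). \<exists>q\<in>mspace (C (act g U)). mdist (C (act g U)) p q > B"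
  proof (intro bexI)
    show "mdist (C (act g U)) (isom g U p) (isom g U q) > B"
      using iso_dist[OF g US pq(1,2)] pq(3) by simp
  qed (use iso_bij[OF g US] pq in \<open>auto dest: bij_betwE\<close>)
qed

definition maximal_unbounded :: "'u set" where
  "maximal_unbounded =
     {U \<in> unbounded_domains \<SS> C. \<forall>V\<in>unbounded_domains \<SS> C. U \<sqsubseteq> V \<longrightarrow> V = U}"

lemma maximal_unbounded_in: "U \<in> maximal_unbounded \<Longrightarrow> U \<in> unbounded_domains \<SS> C"
    "U \<in> maximal_unbounded \<Longrightarrow> U \<in> \<SS>"
  by (auto simp: maximal_unbounded_def unbounded_domains_def)

lemma act_maximal_unbounded:
  assumes g: "g \<in> carrier G" and U: "U \<in> maximal_unbounded"
  shows "act g U \<in> maximal_unbounded"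
  unfolding maximal_unbounded_def
proof (intro CollectI conjI ballI impI)
  show "act g U \<in> unbounded_domains \<SS> C" using act_unbounded[OF g] maximal_unbounded_in(1)[OF U] .
  fix V assume V: "V \<in> unbounded_domains \<SS> C" "act g U \<sqsubseteq> V"
  have VS: "V \<in> \<SS>" using V(1) by (rule unbounded_domains_subset)
  have "act g U \<sqsubseteq> act g (act (inv g) V)" using V(2) act_act_inv[OF g VS] by simp
  then have "U \<sqsubseteq> act (inv g) V"
    using act_nest[OF g, of U "act (inv g) V"] act_closed[of "inv g" V] g VS
      maximal_unbounded_in(2)[OF U] by simp
  then have "act (inv g) V = U"
    using U act_unbounded[of "inv g" V] g V(1) by (auto simp: maximal_unbounded_def)
  then show "V = act g U" using act_act_inv[OF g VS] by simp
qed

lemma nested_in_maximal_unbounded: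
  assumes "U \<in> unbounded_domains \<SS> C"
  shows "\<exists>V\<in>maximal_unbounded. U \<sqsubseteq> V"
proof -
  obtain W where "W \<in> unbounded_domains \<SS> C" "U \<sqsubseteq> W"
      "\<And>V. \<lbrakk>V \<in> unbounded_domains \<SS> C; V \<in> \<SS>; W \<sqsubseteq> V\<rbrakk> \<Longrightarrow> V = W"
    using nested_in_maximal[of "\<lambda>V. V \<in> unbounded_domains \<SS> C" U] assms
      unbounded_domains_subset by metis
  then show ?thesis by (auto simp: maximal_unbounded_def unbounded_domains_subset)
qed

lemma maximal_unbounded_cases:
  assumes "U \<in> maximal_unbounded" "V \<in> maximal_unbounded" "U \<noteq> V" "\<not> U \<bottom> V"
  shows "transverse U V"
  using assms by (auto simp: maximal_unbounded_def transverse_def)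

text \<open>
  A domain of finite diameter has diameter at most \<open>E\<close>, which is what makes the number of
  large links uniform.
\<close>
lemma bounded_domain_dist:
  assumes T: "T \<in> \<SS>" "T \<notin> unbounded_domains \<SS> C" and x: "x \<in> carrier G" and y: "y \<in> carrier G"
  shows "dom_dist T x y \<le> E"
proof -
  obtain B where B: "\<And>p q. \<lbrakk>p \<in> mspace (C T); q \<in> mspace (C T)\<rbrakk> \<Longrightarrow> mdist (C T) p q \<le> B"
    using T unfolding unbounded_domain_iff by (force simp: not_less)
  have "mdiam (C T) (mspace (C T)) \<le> ennreal B"
    unfolding mdiam_def using B by (intro SUP_least ennreal_leI)
  then have "mdiam (C T) (mspace (C T)) < \<infinity>"
    by (rule order.strict_trans1) simp
  then have "mdiam (C T) (mspace (C T)) \<le> ennreal E"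
    using E_diam[OF T(1)] by (metis less_irrefl not_le)
  then show ?thesis
    unfolding dom_dist_def using proj_mspace[OF T(1)] x y E_ge_1
    by (intro mdist_le_of_mdiam_le) auto
qed

text \<open>
  One use of large links replaces a bounded domain by at most \<open>E\<^sup>2 + E\<close> domains of smaller height.
\<close>
lemma relevant_below_bounded:
  assumes "T \<in> \<SS>" "x \<in> carrier G" "y \<in> carrier G"
  defines "relevant \<equiv> \<lambda>T. {W \<in> maximal_unbounded. W \<sqsubseteq> T \<and> dom_dist W x y > E}"
  shows "finite (relevant T) \<and> card (relevant T) \<le> nat \<lfloor>E * E + E\<rfloor> ^ height T"
  using assms(1)
proof (induction "height T" arbitrary: T rule: less_induct)
  case less
  let ?n = "nat \<lfloor>E * E + E\<rfloor>"
  have n: "?n \<ge> 1"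
    using E_ge_1 mult_mono[of 1 E 1 E] by (simp add: le_nat_iff le_floor_iff)
  show ?case
  proof (cases "T \<in> unbounded_domains \<SS> C")
    case True
    then have sub: "relevant T \<subseteq> {T}"
      by (auto simp: relevant_def maximal_unbounded_def)
    have "card (relevant T) \<le> 1" using card_mono[OF _ sub] by simp
    also have "1 \<le> ?n ^ height T" using n by simp
    finally show ?thesis using finite_subset[OF sub] by simp
  next
    case False
    define N where "N = E * dom_dist T x y + E"
    obtain \<T> where \<T>: "\<T> \<subseteq> {T' \<in> \<SS>. T' \<sqsubset> T}" "finite \<T>" "int (card \<T>) \<le> \<lfloor>N\<rfloor>"
        "\<And>W. \<lbrakk>W \<in> \<SS>; W \<sqsubset> T\<rbrakk> \<Longrightarrow> (\<exists>T'\<in>\<T>. W \<sqsubseteq> T') \<or> dom_dist W x y < E"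
      using large_links[OF less.prems, of x y N] assms(2,3) N_def by auto
    have "N \<le> E * E + E"
      unfolding N_def using bounded_domain_dist[OF less.prems False assms(2,3)] E_ge_1
      by (simp add: mult_left_mono)
    then have card\<T>: "card \<T> \<le> ?n"
      using \<T>(3) floor_mono[of N "E * E + E"] by linarith
    have sub: "relevant T \<subseteq> (\<Union>T'\<in>\<T>. relevant T')"
    proof
      fix W assume W: "W \<in> relevant T"
      then have "W \<in> maximal_unbounded" by (simp add: relevant_def)
      then have "W \<in> \<SS>" "W \<noteq> T" using False maximal_unbounded_in by blast+
      then show "W \<in> (\<Union>T'\<in>\<T>. relevant T')"
        using W \<T>(4)[of W] by (force simp: relevant_def pnest_def)
    qed
    have IH: "finite (relevant T') \<and> card (relevant T') \<le> ?n ^ (height T - 1)" if "T' \<in> \<T>" for T'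
    proof -
      have T': "T' \<in> \<SS>" "height T' < height T"
        using that \<T>(1) height_strict_mono less.prems by auto
      then have "?n ^ height T' \<le> ?n ^ (height T - 1)"
        using n by (intro power_increasing) auto
      then show ?thesis using less.hyps[OF T'(2,1)] by linarith
    qed
    have fin: "finite (\<Union>T'\<in>\<T>. relevant T')" using IH \<T>(2) by blast
    have "card (relevant T) \<le> card (\<Union>T'\<in>\<T>. relevant T')" by (rule card_mono[OF fin sub])
    also have "\<dots> \<le> (\<Sum>T'\<in>\<T>. card (relevant T'))" by (rule card_UN_le[OF \<T>(2)])
    also have "\<dots> \<le> card \<T> * ?n ^ (height T - 1)"
      using IH by (intro sum_bounded_above[THEN order_trans]) auto
    finally have le: "card (relevant T) \<le> card \<T> * ?n ^ (height T - 1)" .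
    have "card (relevant T) \<le> ?n ^ height T"
    proof (cases "\<T> = {}")
      case True
      then show ?thesis using le by simp
    next
      case ne: False
      then obtain T' where "height T' < height T"
        using \<T>(1) height_strict_mono less.prems by fastforce
      then have "?n * ?n ^ (height T - 1) = ?n ^ height T"
        by (cases "height T") auto
      then show ?thesis using le card\<T> by (metis mult_le_mono1 order_trans)
    qed
    then show ?thesis using finite_subset[OF sub fin] by blast
  qed
qed


section \<open>Maximal unbounded domains are pairwise orthogonal\<close>

text \<open>
  By the hypothesis \<open>realises\<close>, the element \<open>y\<close> behaves like a point of the product region of
  \<open>V\<close>. In particular it is near $\rho^V_W$ for \<open>W = yx\<^sup>-\<^sup>1V\<close>; now translate by \<open>xy\<^sup>-\<^sup>1\<close>, which
  carries \<open>W\<close> to \<open>V\<close> and \<open>y\<close> to \<open>x\<close>.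
\<close>
lemma translate_near_product_point:
  assumes V: "V \<in> \<SS>" and x: "x \<in> carrier G" and y: "y \<in> carrier G"
    and realises: "\<And>W. \<lbrakk>W \<in> \<SS>; transverse V W\<rbrakk> \<Longrightarrow> near_rho V W y"
    and tr: "transverse (act (inv x) V) (act (inv y) V)"
  shows "transverse (act (x \<otimes> inv y) V) V" "near_rho (act (x \<otimes> inv y) V) V x"
proof -
  let ?g = "x \<otimes> inv y" and ?W = "act (y \<otimes> inv x) V"
  have inS: "act (inv x) V \<in> \<SS>" "act (inv y) V \<in> \<SS>" "?W \<in> \<SS>"
    using V x y by (simp_all add: act_closed)
  have gW: "act ?g ?W = V"
    using act_mult[of "x \<otimes> inv y" "y \<otimes> inv x" V] act_inv_act[of "y \<otimes> inv x" V] V x y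
    by (simp add: inv_mult_group)
  have "transverse V ?W"
    using act_transverse[OF y inS(2,1)] transverse_sym[OF tr inS(1,2)] act_act_inv[OF y V]
      act_mult[of y "inv x" V] x y V by simp
  then have VW: "transverse V ?W" "transverse ?W V"
    using transverse_sym V inS(3) by blast+
  then obtain a where a: "a \<in> \<rho> V ?W" "mdist (C ?W) (\<pi> ?W y) a \<le> E + 1"
    using realises[OF inS(3)] by (auto simp: near_rho_def)
  have g: "?g \<in> carrier G" using x y by simp
  show "transverse (act ?g V) V"
    using act_transverse[OF g V inS(3)] VW(1) gW by simp
  have "isom ?g ?W a \<in> \<rho> (act ?g V) V"
    using rho_equivariant[OF g inS(3) V] VW(2) a(1) gW by auto
  moreover have "isom ?g ?W (\<pi> ?W y) = \<pi> V x"
    using proj_equivariant[OF g y inS(3)] gW x y by (simp add: m_assoc)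
  moreover have "a \<in> mspace (C ?W)"
    using a(1) rho_transverse_bounded(2)[OF VW(1) V inS(3)] by blast
  then have "mdist (C V) (isom ?g ?W (\<pi> ?W y)) (isom ?g ?W a) \<le> E + 1"
    using iso_dist[OF g inS(3), of "\<pi> ?W y" a] proj_mspace[OF inS(3)] y a(2) gW by simp
  ultimately show "near_rho (act ?g V) V x"
    by (auto simp: near_rho_def)
qed

text \<open>
  Assume that all sets $\rho^W_V$ stay within \<open>R\<close> of a base point \<open>a\<close> of $\rho^U_V$, and consider the
  elements \<open>x\<close> of the product region of \<open>V\<close> that project to \<open>C V\<close> outside a slightly larger
  ball around \<open>a\<close>. By the previous lemma the domains \<open>x\<^sup>-\<^sup>1V\<close> are pairwise equal or
  orthogonal, hence finite in number. For two such elements with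
  the same domain, \<open>yx\<^sup>-\<^sup>1\<close> stabilises \<open>V\<close> and carries \<open>a\<close> into $\rho^{yx^{-1}U}_V$, so \<open>y\<close>
  is at most \<open>R\<close> further from \<open>a\<close> than \<open>x\<close> is. Thus the projections of these elements stay in a
  bounded region, although every point of \<open>C V\<close> far enough from \<open>a\<close> is close to one of them.
\<close>
lemma transverse_far_away:
  assumes U: "U \<in> maximal_unbounded" and V: "V \<in> maximal_unbounded" and UV: "transverse U V"
  obtains W where "W \<in> maximal_unbounded" "transverse W V" "separated U V W"
proof (rule ccontr)
  assume "\<not> thesis"
  with that have no: "\<And>W. \<lbrakk>W \<in> maximal_unbounded; transverse W V\<rbrakk> \<Longrightarrow> \<not> separated U V W" by blast
  have S: "U \<in> \<SS>" "V \<in> \<SS>" using U V maximal_unbounded_in by blast+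
  note rhoU = rho_transverse_bounded[OF UV S]
  obtain a where a: "a \<in> \<rho> U V" using rhoU(1) by blast
  have am: "a \<in> mspace (C V)" using a rhoU(2) by blast
  define R where "R = 5 * E + 2"
  have R: "mdist (C V) a b \<le> R"
    if W: "W \<in> maximal_unbounded" "transverse W V" and b: "b \<in> \<rho> W V" for W b
  proof -
    note rhoW = rho_transverse_bounded[OF W(2) maximal_unbounded_in(2)[OF W(1)] S(2)]
    obtain a' b' where ab: "a' \<in> \<rho> U V" "b' \<in> \<rho> W V" "mdist (C V) a' b' \<le> 3 * E + 2"
      using no[OF W] by (auto simp: separated_def not_less)
    have m: "a' \<in> mspace (C V)" "b' \<in> mspace (C V)" "b \<in> mspace (C V)"
      using ab b rhoU(2) rhoW(2) by blast+
    have "mdist (C V) a b \<le> mdist (C V) a a' + mdist (C V) a' b' + mdist (C V) b' b"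
      using mdist_triangle[OF am m(1,3)] mdist_triangle[OF m] by linarith
    also have "\<dots> \<le> R"
      unfolding R_def using ab(3) rhoU(3)[OF a ab(1)] rhoW(3)[OF ab(2) b] by linarith
    finally show ?thesis .
  qed
  define far where "far = {x \<in> carrier G. mdist (C V) a (\<pi> V x) > R + E + 1 \<and>
    (\<forall>W\<in>\<SS>. transverse V W \<longrightarrow> near_rho V W x)}"
  have far_point: "\<exists>x\<in>far. mdist (C V) a (\<pi> V x) > B" for B
  proof -
    obtain p where p: "p \<in> mspace (C V)" "mdist (C V) a p > max B (R + E + 1) + E"
      using unbounded_domain_far_point[OF maximal_unbounded_in(1)[OF V] am] by blast
    obtain x where x: "x \<in> carrier G" "mdist (C V) (\<pi> V x) p \<le> E"
      and near: "\<And>W. \<lbrakk>W \<in> \<SS>; transverse V W\<rbrakk> \<Longrightarrow> dom_setdist W x (\<rho> V W) \<le> ennreal E"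
      using partial_realisation[of "{V}" "\<lambda>_. p"] S(2) p(1) by (auto simp: pairwise_def)
    have px: "\<pi> V x \<in> mspace (C V)" using proj_mspace[OF S(2)] x(1) by simp
    have "mdist (C V) a (\<pi> V x) > max B (R + E + 1)"
      using mdist_triangle[OF am px p(1)] p(2) x(2) by linarith
    then show ?thesis
      using x(1) near near_rhoI unfolding far_def by (intro bexI[of _ x]) auto
  qed
  have "pairwise (\<bottom>) ((\<lambda>x. act (inv x) V) ` far)"
    unfolding pairwise_def
  proof (safe, rule ccontr)
    fix x y assume xy: "x \<in> far" "y \<in> far" "act (inv x) V \<noteq> act (inv y) V"
      "\<not> act (inv x) V \<bottom> act (inv y) V"
    then have xyG: "x \<in> carrier G" "y \<in> carrier G" by (auto simp: far_def)
    have tr: "transverse (act (inv x) V) (act (inv y) V)"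
      using maximal_unbounded_cases[OF _ _ xy(3,4)] act_maximal_unbounded V xyG by simp
    have g: "x \<otimes> inv y \<in> carrier G" using xyG by simp
    have trg: "transverse (act (x \<otimes> inv y) V) V"
      and near: "near_rho (act (x \<otimes> inv y) V) V x"
      using translate_near_product_point[OF S(2) xyG _ tr] xy(2) by (auto simp: far_def)
    then obtain b where b: "b \<in> \<rho> (act (x \<otimes> inv y) V) V" "mdist (C V) (\<pi> V x) b \<le> E + 1"
      by (auto simp: near_rho_def)
    have "b \<in> mspace (C V)"
      using b(1) rho_transverse_bounded(2)[OF trg act_closed[OF g S(2)] S(2)] by blast
    then have "mdist (C V) a (\<pi> V x) \<le> mdist (C V) a b + mdist (C V) b (\<pi> V x)"
      using am proj_mspace[OF S(2)] xyG by (intro mdist_triangle) auto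
    also have "\<dots> \<le> R + (E + 1)"
      using R[OF act_maximal_unbounded[OF g V] trg b(1)] b(2)
      by (simp add: mdist_commute[of _ b])
    finally show False using xy(1) by (simp add: far_def)
  qed
  moreover have "(\<lambda>x. act (inv x) V) ` far \<subseteq> \<SS>"
    using act_closed S(2) by (auto simp: far_def)
  ultimately have fin: "finite ((\<lambda>x. act (inv x) V) ` far)"
    by (intro pairwise_orth_finite)
  have stab: "mdist (C V) a (\<pi> V y) \<le> R + mdist (C V) a (\<pi> V x)"
    if xy: "x \<in> far" "y \<in> far" "act (inv x) V = act (inv y) V" for x y
  proof -
    have G: "x \<in> carrier G" "y \<in> carrier G" "inv x \<in> carrier G" using xy by (auto simp: far_def)
    let ?h = "y \<otimes> inv x"
    have h: "?h \<in> carrier G" using G by simp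
    have hV: "act ?h V = V"
      using act_mult[OF G(2,3) S(2)] act_act_inv[OF G(2) S(2)] xy(3) by simp
    have hx: "isom ?h V (\<pi> V x) = \<pi> V y"
      using proj_equivariant[OF h G(1) S(2)] hV G by (simp add: m_assoc)
    have px: "\<pi> V x \<in> mspace (C V)" "\<pi> V y \<in> mspace (C V)" using proj_mspace[OF S(2)] G by simp_all
    have trh: "transverse (act ?h U) V" using act_transverse[OF h S] UV hV by simp
    have VU: "transverse V U" using transverse_sym[OF UV S] .
    have b: "isom ?h V a \<in> \<rho> (act ?h U) V"
      using rho_equivariant[OF h S(2,1)] VU a hV by auto
    have bm: "isom ?h V a \<in> mspace (C V)"
      using b rho_transverse_bounded(2)[OF trh act_closed[OF h S(1)] S(2)] by blast
    have "mdist (C V) a (\<pi> V y) \<le> mdist (C V) a (isom ?h V a) + mdist (C V) (isom ?h V a) (\<pi> V y)"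
      using am bm px(2) by (intro mdist_triangle)
    also have "mdist (C V) (isom ?h V a) (\<pi> V y) = mdist (C V) a (\<pi> V x)"
      using iso_dist[OF h S(2) am px(1)] hV hx by simp
    also have "mdist (C V) a (isom ?h V a) \<le> R"
      using R[OF act_maximal_unbounded[OF h U] trh b] .
    finally show ?thesis by simp
  qed
  obtain F where F: "finite F" "F \<subseteq> far" "(\<lambda>x. act (inv x) V) ` far = (\<lambda>x. act (inv x) V) ` F"
    using finite_subset_image[OF fin order_refl] by metis
  define B where "B = Max (insert 0 ((\<lambda>x. mdist (C V) a (\<pi> V x)) ` F))"
  obtain y where y: "y \<in> far" "mdist (C V) a (\<pi> V y) > R + B" using far_point by blast
  then have "act (inv y) V \<in> (\<lambda>x. act (inv x) V) ` F" using F(3) by blast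
  then obtain x where x: "x \<in> F" "act (inv y) V = act (inv x) V" by blast
  have "mdist (C V) a (\<pi> V x) \<le> B"
    unfolding B_def using x(1) F(1) by (intro Max_ge) auto
  moreover have "mdist (C V) a (\<pi> V y) \<le> R + mdist (C V) a (\<pi> V x)"
    using x y(1) F(2) by (intro stab) auto
  ultimately show False using y(2) by linarith
qed

lemma maximal_unbounded_not_transverse:
  assumes U: "U \<in> maximal_unbounded" and V: "V \<in> maximal_unbounded"
  shows "\<not> transverse U V"
proof
  assume UV: "transverse U V"
  let ?P = "\<lambda>p. fst p \<in> maximal_unbounded \<and> snd p \<in> maximal_unbounded \<and> transverse (fst p) (snd p)"
  \<comment> \<open>A step of the recursion shifts the pair of consecutive domains by one.\<close>
  have "\<exists>p. \<forall>n. ?P (p n) \<and>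
      (fst (p (Suc n)) = snd (p n) \<and> separated (fst (p n)) (snd (p n)) (snd (p (Suc n))))"
  proof (rule dependent_nat_choice)
    show "\<exists>p. ?P p" using U V UV by (intro exI[of _ "(U, V)"]) simp
    fix p :: "'u \<times> 'u" and n :: nat
    assume p: "?P p"
    then obtain W where W: "W \<in> maximal_unbounded" "transverse W (snd p)"
        "separated (fst p) (snd p) W"
      using transverse_far_away[of "fst p" "snd p"] by metis
    then have "transverse (snd p) W" using p transverse_sym maximal_unbounded_in(2) by blast
    then show "\<exists>q. ?P q \<and> (fst q = snd p \<and> separated (fst p) (snd p) (snd q))"
      using W p by (intro exI[of _ "(snd p, W)"]) simp
  qed
  then obtain p where p: "\<And>n. ?P (p n)" "\<And>n. fst (p (Suc n)) = snd (p n)"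
      "\<And>n. separated (fst (p n)) (snd (p n)) (snd (p (Suc n)))" by blast
  define f where "f n = fst (p n)" for n
  have f: "f n \<in> maximal_unbounded" "transverse (f n) (f (Suc n))"
      "separated (f n) (f (Suc n)) (f (Suc (Suc n)))" for n
    using p(1)[of n] p(2)[of n] p(2)[of "Suc n"] p(3)[of n] by (simp_all add: f_def)
  then have chain: "transverse_chain f" and ub: "\<And>i. f i \<in> unbounded_domains \<SS> C"
    using maximal_unbounded_in by (auto simp: transverse_chain_def)
  obtain T where T: "T \<in> \<SS>" "\<And>U. U \<in> \<SS> \<Longrightarrow> U \<sqsubseteq> T"
    using top_domain maximal_unbounded_in(2)[OF U] by blast
  define n where "n = Suc (nat \<lfloor>E * E + E\<rfloor> ^ height T)"
  obtain x y where xy: "x \<in> carrier G" "y \<in> carrier G"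
      "\<And>i. \<lbrakk>0 < i; i \<le> n\<rbrakk> \<Longrightarrow> dom_dist (f i) x y > E"
    using transverse_chain_many_relevant[OF chain ub, of n] by auto
  let ?R = "{W \<in> maximal_unbounded. W \<sqsubseteq> T \<and> dom_dist W x y > E}"
  have "f ` {1..n} \<subseteq> ?R" using xy(3) f(1) T(2) maximal_unbounded_in(2) by auto
  moreover have "finite ?R" "card ?R < n"
    using relevant_below_bounded[OF T(1) xy(1,2)] by (simp_all add: n_def)
  ultimately have "card (f ` {1..n}) < n" using card_mono order.strict_trans1 by blast
  moreover have "card (f ` {1..n}) = n"
    using transverse_chain_inj[OF chain ub] by (simp add: card_image inj_on_subset)
  ultimately show False by simp
qed

lemma maximal_unbounded_pairwise_orth: "pairwise (\<bottom>) maximal_unbounded"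
  using maximal_unbounded_cases maximal_unbounded_not_transverse unfolding pairwise_def by blast

end

theorem theorem3p2:
  fixes G :: "('g, 'b) monoid_scheme"
    and A :: "'g set"
    and \<SS> :: "'u set"
    and E :: real
    and C :: "'u \<Rightarrow> 'c metric"
    and \<pi> :: "'u \<Rightarrow> 'g \<Rightarrow> 'c"
    and nest orth :: "'u \<Rightarrow> 'u \<Rightarrow> bool"
    and \<rho> :: "'u \<Rightarrow> 'u \<Rightarrow> 'c set"
    and \<rho>map :: "'u \<Rightarrow> 'u \<Rightarrow> 'c \<Rightarrow> 'c set"
    and act :: "'g \<Rightarrow> 'u \<Rightarrow> 'u"
    and isom :: "'g \<Rightarrow> 'u \<Rightarrow> 'c \<Rightarrow> 'c"
  assumes "hhg G A \<SS> E C \<pi> nest orth \<rho> \<rho>map act isom"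
  shows "\<exists>\<E>. finite \<E> \<and> \<E> \<subseteq> unbounded_domains \<SS> C \<and>
           (\<forall>g\<in>carrier G. act g ` \<E> = \<E>) \<and>
           pairwise orth \<E> \<and>
           (\<forall>U\<in>unbounded_domains \<SS> C. \<exists>V\<in>\<E>. nest U V)"
proof -
  interpret hhg G A \<SS> E C \<pi> nest orth \<rho> \<rho>map act isom by (rule assms)
  show ?thesis
  proof (intro exI[of _ maximal_unbounded] conjI ballI)
    show "finite maximal_unbounded"
      using maximal_unbounded_pairwise_orth maximal_unbounded_in(2)
      by (intro pairwise_orth_finite) auto
    show "maximal_unbounded \<subseteq> unbounded_domains \<SS> C"
      using maximal_unbounded_in(1) by blast
    show "pairwise orth maximal_unbounded" by (rule maximal_unbounded_pairwise_orth)
    show "\<exists>V\<in>maximal_unbounded. nest U V" if "U \<in> unbounded_domains \<SS> C" for U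
      using that by (rule nested_in_maximal_unbounded)
    show "act g ` maximal_unbounded = maximal_unbounded" if g: "g \<in> carrier G" for g
    proof
      show "act g ` maximal_unbounded \<subseteq> maximal_unbounded"
        using act_maximal_unbounded[OF g] by blast
      show "maximal_unbounded \<subseteq> act g ` maximal_unbounded"
      proof
        fix U assume U: "U \<in> maximal_unbounded"
        have "act g (act (inv\<^bsub>G\<^esub> g) U) = U"
          using act_act_inv[OF g] maximal_unbounded_in(2)[OF U] .
        moreover have "act (inv\<^bsub>G\<^esub> g) U \<in> maximal_unbounded"
          using act_maximal_unbounded[OF _ U] g by simp
        ultimately show "U \<in> act g ` maximal_unbounded" by (metis imageI)
      qed
    qed
  qed
qed

end
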